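(* Let $\Omega\subset\mathbb{R}^3$ be the open unit ball, let $\gamma\in C^2(\overline\Omega)$ be a positive function with $\gamma=1$ in a neighborhood of $\partial\Omega$, and let $q=\gamma^{-1/2}\Delta\gamma^{1/2}$, extended by $0$ to $\mathbb{R}^3$. Let $\mathbf{t}$ be the scattering transform of $q$ as defined in the context. Suppose $q$ is spherically symmetric (i.e. $q(x)$ depends only on $|x|$). Then $\mathbf{t}$ is real: $$\overline{\mathbf{t}(\xi,\zeta)}=\mathbf{t}(\xi,\zeta)\quad\text{for all }\xi\in\mathbb{R}^3\text{ and all admissible }\zeta\in\mathcal{V}_\xi .$$
   Context: For $a,b\in\mathbb{C}^3$, $a\cdot b=\sum_j a_jb_j$ (bilinear, no conjugation), $a^2=a\cdot a$. Set $\mathcal{V}=\{\zeta\in\mathbb{C}^3\setminus\{0\}:\zeta\cdot\zeta=0\}$ and, for $\xi\in\mathbb{R}^3$, $\mathcal{V}_\xi=\{\zeta\in\mathcal{V}:(\xi+\zeta)^2=0\}$. Complex geometrical optics solutions: for $\zeta\in\mathcal{V}$ let $g_\zeta(x)=\frac{1}{(2\pi)^3}\int_{\mathbb{R}^3}\frac{e^{ix\cdot\eta}}{|\eta|^2+2\eta\cdot\zeta}\,d\eta$, understood as the inverse Fourier transform of a tempered distribution. Fix $\delta\in(-1,0)$ and let $L^2_\delta(\mathbb{R}^3)$ be the weighted space with norm $\left(\int(1+|x|^2)^\delta|f(x)|^2dx\right)^{1/2}$. Call $\zeta\in\mathcal{V}$ admissible if the equation $\mu+g_\zeta*(q\mu)=1$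 in $\mathbb{R}^3$ has a unique solution $\mu=\mu(\cdot,\zeta)$ with $\mu-1\in L^2_\delta(\mathbb{R}^3)$; in that case set $\psi(x,\zeta)=e^{ix\cdot\zeta}\mu(x,\zeta)$. Scattering transform: for $\xi\in\mathbb{R}^3$ and admissible $\zeta\in\mathcal{V}$, $$\mathbf{t}(\xi,\zeta)=\int_\Omega e^{-ix\cdot(\xi+\zeta)}\psi(x,\zeta)q(x)\,dx .$$ *)

theory Defs
  imports "HOL-Analysis.Analysis"
begin

type_synonym R3 = "real ^ 3"
type_synonym C3 = "complex ^ 3"


subsection \<open>Complex vectors\<close>

text \<open>The dot product on complex vectors is bilinear: there is no conjugation.\<close>

definition cdot :: "C3 \<Rightarrow> C3 \<Rightarrow> complex" (infixl \<open>\<odot>\<close> 70) where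
  "a \<odot> b = (\<Sum>j\<in>UNIV. a $ j * b $ j)"

definition cvec :: "R3 \<Rightarrow> C3" where
  "cvec x = (\<chi> j. complex_of_real (x $ j))"

definition V :: "C3 set" where
  "V = {\<zeta>. \<zeta> \<noteq> 0 \<and> \<zeta> \<odot> \<zeta> = 0}"

definition V_at :: "R3 \<Rightarrow> C3 set" where
  "V_at \<xi> = {\<zeta> \<in> V. (cvec \<xi> + \<zeta>) \<odot> (cvec \<xi> + \<zeta>) = 0}"


subsection \<open>Derivatives, the conductivity and the potential\<close>

definition dir_deriv :: "R3 \<Rightarrow> (R3 \<Rightarrow> 'b::real_normed_vector) \<Rightarrow> R3 \<Rightarrow> 'b" where
  "dir_deriv v f x = frechet_derivative f (at x) v"

abbreviation partial :: "3 \<Rightarrow> (R3 \<Rightarrow> 'b::real_normed_vector) \<Rightarrow> R3 \<Rightarrow> 'b" where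
  "partial i \<equiv> dir_deriv (axis i 1)"

definition laplacian :: "(R3 \<Rightarrow> real) \<Rightarrow> R3 \<Rightarrow> real" where
  "laplacian f x = (\<Sum>i\<in>UNIV. partial i (partial i f) x)"

definition extends_continuously :: "R3 set \<Rightarrow> (R3 \<Rightarrow> real) \<Rightarrow> bool" where
  "extends_continuously D f \<longleftrightarrow>
     (\<exists>g. continuous_on (closure D) g \<and> (\<forall>x\<in>D. g x = f x))"

text \<open>The space of twice continuously differentiable functions on the closure of an open
  set \<open>D\<close>: all partial derivatives up to order two exist in \<open>D\<close> and extend continuously to
  the closure. The values of \<open>f\<close> off the closure are irrelevant.\<close>

definition C2_closure :: "R3 set \<Rightarrow> (R3 \<Rightarrow> real) \<Rightarrow> bool" where
  "C2_closure D f \<longleftrightarrow>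
     continuous_on (closure D) f \<and>
     f differentiable_on D \<and>
     (\<forall>i. partial i f differentiable_on D \<and> extends_continuously D (partial i f)) \<and>
     (\<forall>i j. extends_continuously D (partial i (partial j f)))"

abbreviation Omega :: "R3 set" (\<open>\<Omega>\<close>) where
  "\<Omega> \<equiv> ball 0 1"

definition potential :: "(R3 \<Rightarrow> real) \<Rightarrow> R3 \<Rightarrow> real" where
  "potential \<gamma> x =
     (if x \<in> \<Omega> then laplacian (\<lambda>y. sqrt (\<gamma> y)) x / sqrt (\<gamma> x) else 0)"

definition spherically_symmetric :: "(R3 \<Rightarrow> real) \<Rightarrow> bool" where
  "spherically_symmetric q \<longleftrightarrow> (\<forall>x y. norm x = norm y \<longrightarrow> q x = q y)"


subsection \<open>Tempered distributions\<close>

text \<open>A tempered distribution is represented by its action on Schwartz functions; its values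
  on other functions are never used.\<close>

type_synonym distribution = "(R3 \<Rightarrow> complex) \<Rightarrow> complex"

definition schwartz :: "(R3 \<Rightarrow> complex) \<Rightarrow> bool" where
  "schwartz \<phi> \<longleftrightarrow>
     (\<forall>vs :: R3 list.
        foldr dir_deriv vs \<phi> differentiable_on UNIV \<and>
        (\<forall>k::nat. \<exists>C. \<forall>x. norm x ^ k * norm (foldr dir_deriv vs \<phi> x) \<le> C))"

definition dist_of :: "(R3 \<Rightarrow> complex) \<Rightarrow> distribution" where
  "dist_of h = (\<lambda>\<phi>. LINT x|lborel. h x * \<phi> x)"

definition inv_fourier :: "(R3 \<Rightarrow> complex) \<Rightarrow> R3 \<Rightarrow> complex" where
  "inv_fourier \<phi> \<eta> =
     complex_of_real (1 / (2 * pi) ^ 3) * (LINT x|lborel. exp (\<i> * complex_of_real (x \<bullet> \<eta>)) * \<phi> x)"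

definition inv_fourier_dist :: "distribution \<Rightarrow> distribution" where
  "inv_fourier_dist T = (\<lambda>\<phi>. T (inv_fourier \<phi>))"

text \<open>Convolution of a tempered distribution with a compactly supported integrable function
  \<open>f\<close>: the pairing of \<open>T * f\<close> with \<open>\<phi>\<close> is the pairing of \<open>T\<close> with the Schwartz function
  obtained by convolving \<open>\<phi>\<close> with the reflection of \<open>f\<close>.\<close>

definition conv_dist :: "distribution \<Rightarrow> (R3 \<Rightarrow> complex) \<Rightarrow> distribution" where
  "conv_dist T f = (\<lambda>\<phi>. T (\<lambda>x. LINT y|lborel. f y * \<phi> (x + y)))"


subsection \<open>Complex geometrical optics solutions and the scattering transform\<close>

text \<open>For \<open>\<zeta> \<in> V\<close> the denominator vanishes only on a circle, and its reciprocal is locally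
  integrable and bounded near infinity, hence a tempered distribution.\<close>

definition g_faddeev :: "C3 \<Rightarrow> distribution" where
  "g_faddeev \<zeta> =
     inv_fourier_dist
       (dist_of (\<lambda>\<eta>. 1 / (complex_of_real ((norm \<eta>)\<^sup>2) + 2 * (cvec \<eta> \<odot> \<zeta>))))"

definition weighted_L2 :: "real \<Rightarrow> (R3 \<Rightarrow> complex) set" where
  "weighted_L2 \<delta> =
     {f \<in> borel_measurable lborel.
        integrable lborel (\<lambda>x. (1 + (norm x)\<^sup>2) powr \<delta> * (norm (f x))\<^sup>2)}"

text \<open>The equation \<open>\<mu> + g * (q \<mu>) = 1\<close> is an equation of tempered distributions. The
  potential \<open>q\<close> is meant to be bounded with compact support, so that \<open>q \<mu>\<close> is integrable
  with compact support.\<close>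

definition cgo_solution :: "real \<Rightarrow> (R3 \<Rightarrow> real) \<Rightarrow> C3 \<Rightarrow> (R3 \<Rightarrow> complex) \<Rightarrow> bool" where
  "cgo_solution \<delta> q \<zeta> \<mu> \<longleftrightarrow>
     (\<lambda>x. \<mu> x - 1) \<in> weighted_L2 \<delta> \<and>
     (\<forall>\<phi>. schwartz \<phi> \<longrightarrow>
        dist_of \<mu> \<phi> + conv_dist (g_faddeev \<zeta>) (\<lambda>x. complex_of_real (q x) * \<mu> x) \<phi>
          = dist_of (\<lambda>_. 1) \<phi>)"

text \<open>Elements of the weighted space are functions up to null sets, so uniqueness is almost
  everywhere uniqueness.\<close>

definition admissible :: "real \<Rightarrow> (R3 \<Rightarrow> real) \<Rightarrow> C3 \<Rightarrow> bool" where
  "admissible \<delta> q \<zeta> \<longleftrightarrow>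
     \<zeta> \<in> V \<and>
     (\<exists>\<mu>. cgo_solution \<delta> q \<zeta> \<mu> \<and>
        (\<forall>\<nu>. cgo_solution \<delta> q \<zeta> \<nu> \<longrightarrow> (AE x in lborel. \<nu> x = \<mu> x)))"

definition cgo_mu :: "real \<Rightarrow> (R3 \<Rightarrow> real) \<Rightarrow> C3 \<Rightarrow> R3 \<Rightarrow> complex" where
  "cgo_mu \<delta> q \<zeta> = (SOME \<mu>. cgo_solution \<delta> q \<zeta> \<mu>)"

definition cgo_psi :: "real \<Rightarrow> (R3 \<Rightarrow> real) \<Rightarrow> C3 \<Rightarrow> R3 \<Rightarrow> complex" where
  "cgo_psi \<delta> q \<zeta> x = exp (\<i> * (cvec x \<odot> \<zeta>)) * cgo_mu \<delta> q \<zeta> x"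

definition scattering :: "real \<Rightarrow> (R3 \<Rightarrow> real) \<Rightarrow> R3 \<Rightarrow> C3 \<Rightarrow> complex" where
  "scattering \<delta> q \<xi> \<zeta> =
     (LINT x:\<Omega>|lborel.
        exp (- \<i> * (cvec x \<odot> (cvec \<xi> + \<zeta>))) * cgo_psi \<delta> q \<zeta> x * complex_of_real (q x))"

end

theory Submission
  imports Defs
begin

text \<open>Write \<open>\<zeta> = a + ib\<close>. The condition \<open>\<zeta> \<in> V_at \<xi>\<close> forces \<open>a\<close> and \<open>\<xi>\<close> to be orthogonal to \<open>b\<close>, so
  the rotation \<open>S\<close> by the angle \<open>\<pi>\<close> about \<open>b\<close> maps \<open>\<xi>\<close> to \<open>-\<xi>\<close> and \<open>\<zeta>\<close> to minus its conjugate.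
  Conjugation followed by \<open>S\<close> therefore preserves the equation for \<open>\<mu>(\<cdot>,\<zeta>)\<close> whenever
  \<open>q \<circ> S = q\<close>, and by uniqueness the conjugate of \<open>\<mu> \<circ> S\<close> equals \<open>\<mu>\<close> almost everywhere.
  Substituting \<open>S x\<close> for \<open>x\<close> in the integral for the conjugate of \<open>t(\<xi>,\<zeta>)\<close> gives back \<open>t(\<xi>,\<zeta>)\<close>.\<close>

section \<open>Isometric involutions\<close>

text \<open>Two instances occur: the half turn itself and, on the frequency side, its negative. For
  an involution, preimages are images and the map is self-adjoint.\<close>

locale isometric_involution =
  fixes S :: "R3 \<Rightarrow> R3"
  assumes orth: "orthogonal_transformation S"
    and invol [simp]: "S (S x) = x"
begin

lemma linear: "linear S"
  using orth by (simp add: orthogonal_transformation_linear)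

lemma norm_S [simp]: "norm (S x) = norm x"
  using orth by (simp add: orthogonal_transformation)

lemma adjoint: "S x \<bullet> y = x \<bullet> S y"
proof -
  have "S x \<bullet> S (S y) = x \<bullet> S y"
    using orth unfolding orthogonal_transformation_def by blast
  then show ?thesis by simp
qed

lemma bounded_linear_S: "bounded_linear S"
  using linear by (rule linear_conv_bounded_linear[THEN iffD1])

lemma has_derivative_S: "(S has_derivative S) F"
  using bounded_linear_S by (rule bounded_linear_imp_has_derivative)

lemma measurable_S [measurable]: "S \<in> borel_measurable borel"
  by (intro borel_measurable_continuous_onI linear_continuous_on bounded_linear_S)

lemma vimage_eq_image: "S -` A = S ` A"
  by (auto simp: image_iff) (metis invol)

section \<open>Invariance of Lebesgue measure\<close>

text \<open>Lebesgue measure is determined by its values on boxes, and an orthogonal map preserves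
  the measure of a box.\<close>

lemma distr_lborel: "distr lborel lborel S = lborel"
proof -
  have "lborel = distr lborel borel S"
  proof (rule lborel_eqI)
    fix l u :: R3 assume lu: "\<And>b. b \<in> Basis \<Longrightarrow> l \<bullet> b \<le> u \<bullet> b"
    have img: "S ` box l u \<in> lmeasurable"
      using linear lmeasurable_box by (rule measurable_linear_image)
    have sets: "S ` box l u \<in> sets borel"
      using measurable_sets[OF measurable_S, of "box l u"] by (simp add: vimage_eq_image)
    have "emeasure (distr lborel borel S) (box l u) = emeasure lborel (S ` box l u)"
      by (subst emeasure_distr) (auto simp: vimage_eq_image)
    also have "\<dots> = emeasure lebesgue (S ` box l u)"
      using sets by simp
    also have "\<dots> = ennreal (measure lebesgue (S ` box l u))"
      using img by (rule emeasure_eq_measure2)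
    also have "\<dots> = ennreal (measure lebesgue (box l u))"
      using measure_orthogonal_image[OF orth lmeasurable_box] by simp
    also have "\<dots> = (\<Prod>b\<in>Basis. (u - l) \<bullet> b)"
      using lu by (simp add: measure_lborel_box_eq)
    finally show "emeasure (distr lborel borel S) (box l u) = (\<Prod>b\<in>Basis. (u - l) \<bullet> b)" .
  qed simp
  also have "\<dots> = distr lborel lborel S"
    by (rule distr_cong) auto
  finally show ?thesis by simp
qed

lemma measurable_compose_iff:
  "(\<lambda>x. f (S x)) \<in> borel_measurable lborel \<longleftrightarrow> f \<in> borel_measurable lborel"
proof
  assume "(\<lambda>x. f (S x)) \<in> borel_measurable lborel"
  then have "(\<lambda>x. f (S (S x))) \<in> borel_measurable lborel"
    by (rule measurable_compose[rotated]) simp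
  then show "f \<in> borel_measurable lborel" by simp
next
  assume "f \<in> borel_measurable lborel"
  then show "(\<lambda>x. f (S x)) \<in> borel_measurable lborel"
    by (rule measurable_compose[rotated]) simp
qed

lemma integrable_compose:
  fixes f :: "R3 \<Rightarrow> 'b::{banach, second_countable_topology}"
  assumes "integrable lborel f"
  shows "integrable lborel (\<lambda>x. f (S x))"
  using integrable_distr[of S lborel lborel f] assms by (simp add: distr_lborel)

lemma integral_compose:
  fixes f :: "R3 \<Rightarrow> 'b::{banach, second_countable_topology}"
  shows "(LINT x|lborel. f (S x)) = (LINT x|lborel. f x)"
proof (cases "f \<in> borel_measurable lborel")
  case True
  then show ?thesis
    using integral_distr[of S lborel lborel f] by (simp add: distr_lborel)
next
  \<comment> \<open>The integral of a function that is not integrable is 0 by convention, so both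
    sides vanish. Thus later identities hold for arbitrary functions.\<close>
  case False
  then have "\<not> integrable lborel f" "\<not> integrable lborel (\<lambda>x. f (S x))"
    using borel_measurable_integrable measurable_compose_iff[of f] by blast+
  then show ?thesis
    by (simp add: not_integrable_integral_eq)
qed

section \<open>The twist on functions and distributions\<close>

text \<open>An antilinear, multiplicative involution. If \<open>S\<close> carries \<zeta> to minus
  its conjugate, the twist fixes the exponential of
  \<open>\<i> * (cvec x \<odot> \<zeta>)\<close>.\<close>

definition twist :: "(R3 \<Rightarrow> complex) \<Rightarrow> R3 \<Rightarrow> complex" where
  "twist f x = cnj (f (S x))"

lemma integral_twist: "(LINT x|lborel. twist f x) = cnj (LINT x|lborel. f x)"
  unfolding twist_def by (subst integral_compose[where f = "\<lambda>x. cnj (f x)"]) simp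

text \<open>The chain rule moves \<open>S\<close> onto the direction; conjugation is real linear and
  commutes with the derivative.\<close>

lemma dir_deriv_twist:
  assumes "f differentiable_on UNIV"
  shows "dir_deriv v (twist f) = twist (dir_deriv (S v) f)"
    and "twist f differentiable_on UNIV"
proof -
  have D: "(twist f has_derivative (\<lambda>v. cnj (frechet_derivative f (at (S x)) (S v)))) (at x)" for x
  proof -
    have "(f has_derivative frechet_derivative f (at (S x))) (at (S x))"
      using assms by (simp add: differentiable_on_def frechet_derivative_works)
    then have "((\<lambda>x. f (S x)) has_derivative (\<lambda>v. frechet_derivative f (at (S x)) (S v))) (at x)"
      using has_derivative_S by (rule has_derivative_compose[rotated])
    then show ?thesis
      unfolding twist_def by (rule has_derivative_cnj)
  qed
  show "dir_deriv v (twist f) = twist (dir_deriv (S v) f)"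
    using frechet_derivative_at[OF D] by (auto simp: dir_deriv_def twist_def fun_eq_iff)
  show "twist f differentiable_on UNIV"
    using D by (auto simp: differentiable_on_def differentiable_def)
qed

text \<open>Each derivative of the twist is the twist of a derivative in the directions
  \<open>map S vs\<close>. Since \<open>S\<close> preserves norms, the bound for those directions
  serves again.\<close>

lemma schwartz_twist:
  assumes "schwartz \<phi>"
  shows "schwartz (twist \<phi>)"
proof -
  have diff: "foldr dir_deriv vs \<phi> differentiable_on UNIV" for vs
    using assms by (simp add: schwartz_def)
  have eq: "foldr dir_deriv vs (twist \<phi>) = twist (foldr dir_deriv (map S vs) \<phi>)" for vs
    by (induction vs) (simp_all add: dir_deriv_twist(1)[OF diff])
  show ?thesis
    unfolding schwartz_def
  proof (intro allI conjI)
    fix vs :: "R3 list" and k :: nat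
    show "foldr dir_deriv vs (twist \<phi>) differentiable_on UNIV"
      unfolding eq by (rule dir_deriv_twist(2)[OF diff])
    obtain C where C: "norm x ^ k * norm (foldr dir_deriv (map S vs) \<phi> x) \<le> C" for x
      using assms unfolding schwartz_def by blast
    have "norm x ^ k * norm (foldr dir_deriv vs (twist \<phi>) x) \<le> C" for x
      unfolding eq twist_def using C[of "S x"] by simp
    then show "\<exists>C. \<forall>x. norm x ^ k * norm (foldr dir_deriv vs (twist \<phi>) x) \<le> C" by blast
  qed
qed

text \<open>Being multiplicative and involutive, the twist sends \<open>h * twist \<phi>\<close> to
  \<open>twist h * \<phi>\<close>.\<close>

lemma dist_of_twist: "dist_of (twist h) \<phi> = cnj (dist_of h (twist \<phi>))"
proof -
  have "dist_of (twist h) \<phi> = (LINT x|lborel. twist (\<lambda>x. h x * twist \<phi> x) x)"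
    by (simp add: dist_of_def twist_def)
  also have "\<dots> = cnj (dist_of h (twist \<phi>))"
    by (simp only: integral_twist dist_of_def)
  finally show ?thesis .
qed

text \<open>Conjugation reverses the sign of the exponent and \<open>S\<close> is self-adjoint, so
  the inverse Fourier transform turns the twist by \<open>S\<close> into the twist by
  \<open>- S\<close>.\<close>

lemma inv_fourier_twist: "inv_fourier (twist f) \<eta> = cnj (inv_fourier f (- S \<eta>))"
proof -
  have "(LINT x|lborel. exp (\<i> * complex_of_real (x \<bullet> \<eta>)) * twist f x) =
      (LINT x|lborel. twist (\<lambda>x. exp (\<i> * complex_of_real (x \<bullet> - S \<eta>)) * f x) x)"
    by (simp add: twist_def exp_cnj adjoint)
  also have "\<dots> = cnj (LINT x|lborel. exp (\<i> * complex_of_real (x \<bullet> - S \<eta>)) * f x)"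
    by (rule integral_twist)
  finally show ?thesis by (simp add: inv_fourier_def)
qed

lemma isometric_involution_minus: "isometric_involution (\<lambda>x. - S x)"
proof
  show "orthogonal_transformation (\<lambda>x. - S x)"
    using orth by (simp add: orthogonal_transformation_neg)
  show "- S (- S x) = x" for x
    using linear by (simp add: linear_neg)
qed

section \<open>Symmetry of the integral equation\<close>

text \<open>Under \<open>- S\<close> the pairing of \<eta> with \<zeta> is conjugated and the norm
  of \<eta> is kept. Hence the Fourier multiplier is fixed by the twist for
  \<open>- S\<close>.\<close>

lemma g_faddeev_twist:
  assumes \<zeta>: "\<And>\<eta>. cvec (S \<eta>) \<odot> \<zeta> = - cnj (cvec \<eta> \<odot> \<zeta>)"
  shows "g_faddeev \<zeta> (twist f) = cnj (g_faddeev \<zeta> f)"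
proof -
  interpret neg: isometric_involution "\<lambda>x. - S x"
    by (rule isometric_involution_minus)
  have *: "cvec (- S \<eta>) \<odot> \<zeta> = cnj (cvec \<eta> \<odot> \<zeta>)" for \<eta>
  proof -
    have "cvec (- S \<eta>) \<odot> \<zeta> = - (cvec (S \<eta>) \<odot> \<zeta>)"
      by (simp add: cvec_def cdot_def sum_negf)
    then show ?thesis using \<zeta> by simp
  qed
  let ?h = "\<lambda>\<eta>. 1 / (complex_of_real ((norm \<eta>)\<^sup>2) + 2 * (cvec \<eta> \<odot> \<zeta>))"
  have "neg.twist ?h = ?h"
    by (simp add: neg.twist_def * fun_eq_iff)
  moreover have "neg.twist (inv_fourier (twist f)) = inv_fourier f"
    using neg.invol by (simp add: neg.twist_def inv_fourier_twist fun_eq_iff)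
  ultimately show ?thesis
    using neg.dist_of_twist[of ?h "inv_fourier (twist f)"]
    by (simp add: g_faddeev_def inv_fourier_dist_def)
qed

text \<open>The equation for \<open>twist \<mu>\<close> tested against \<phi> is the conjugate of
  the equation for \<mu> tested against \<open>twist \<phi>\<close>.\<close>

lemma cgo_solution_twist:
  assumes \<zeta>: "\<And>\<eta>. cvec (S \<eta>) \<odot> \<zeta> = - cnj (cvec \<eta> \<odot> \<zeta>)"
    and q: "\<And>x. q (S x) = q x"
    and \<mu>: "cgo_solution \<delta> q \<zeta> \<mu>"
  shows "cgo_solution \<delta> q \<zeta> (twist \<mu>)"
  unfolding cgo_solution_def
proof (intro conjI allI impI)
  have meas: "(\<lambda>x. \<mu> x - 1) \<in> borel_measurable lborel"
    and int: "integrable lborel (\<lambda>x. (1 + (norm x)\<^sup>2) powr \<delta> * (norm (\<mu> x - 1))\<^sup>2)"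
    using \<mu> by (auto simp: cgo_solution_def weighted_L2_def)
  have eq: "twist \<mu> x - 1 = cnj (\<mu> (S x) - 1)" for x
    by (simp add: twist_def)
  have "(\<lambda>x. \<mu> (S x) - 1) \<in> borel_measurable lborel"
    using meas measurable_compose_iff[of "\<lambda>x. \<mu> x - 1"] by simp
  then have "(\<lambda>x. cnj (\<mu> (S x) - 1)) \<in> borel_measurable lborel"
    by (rule measurable_compose) (auto intro!: borel_measurable_continuous_onI continuous_intros)
  then show "(\<lambda>x. twist \<mu> x - 1) \<in> weighted_L2 \<delta>"
    using integrable_compose[OF int] unfolding weighted_L2_def mem_Collect_eq eq complex_mod_cnj
    by (simp only: norm_S)
next
  fix \<phi> assume \<phi>: "schwartz \<phi>"
  let ?f = "\<lambda>x. complex_of_real (q x) * \<mu> x"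
  let ?conv = "\<lambda>f \<phi> x. LINT y|lborel. f y * \<phi> (x + y)"
  have "?conv (\<lambda>x. complex_of_real (q x) * twist \<mu> x) \<phi> = twist (?conv ?f (twist \<phi>))"
  proof
    fix x
    \<comment> \<open>Linearity turns \<open>S (S x + S y)\<close> into \<open>x + y\<close>, which
      explains the shift by \<open>S x\<close> on the right.\<close>
    have "?conv (\<lambda>x. complex_of_real (q x) * twist \<mu> x) \<phi> x =
        (LINT y|lborel. twist (\<lambda>y. ?f y * twist \<phi> (S x + y)) y)"
      using linear by (simp add: twist_def q linear_add)
    also have "\<dots> = twist (?conv ?f (twist \<phi>)) x"
      by (simp only: integral_twist) (simp add: twist_def)
    finally show "?conv (\<lambda>x. complex_of_real (q x) * twist \<mu> x) \<phi> x = twist (?conv ?f (twist \<phi>)) x" .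
  qed
  then have "conv_dist (g_faddeev \<zeta>) (\<lambda>x. complex_of_real (q x) * twist \<mu> x) \<phi> =
      cnj (conv_dist (g_faddeev \<zeta>) ?f (twist \<phi>))"
    by (simp add: conv_dist_def g_faddeev_twist[OF \<zeta>])
  moreover have "dist_of (\<lambda>_. 1) \<phi> = cnj (dist_of (\<lambda>_. 1) (twist \<phi>))"
    using dist_of_twist[of "\<lambda>_. 1" \<phi>] unfolding twist_def[of "\<lambda>_. 1"] by simp
  moreover have "dist_of \<mu> (twist \<phi>) + conv_dist (g_faddeev \<zeta>) ?f (twist \<phi>) =
      dist_of (\<lambda>_. 1) (twist \<phi>)"
    using \<mu> schwartz_twist[OF \<phi>] by (simp add: cgo_solution_def)
  ultimately show "dist_of (twist \<mu>) \<phi> +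
      conv_dist (g_faddeev \<zeta>) (\<lambda>x. complex_of_real (q x) * twist \<mu> x) \<phi> = dist_of (\<lambda>_. 1) \<phi>"
    by (simp only: dist_of_twist complex_cnj_add[symmetric])
qed

end

section \<open>Half turns\<close>

text \<open>Twice the orthogonal projection onto the line of \<open>b\<close>, minus the identity:
  the rotation by \<pi> about \<open>b\<close>. For \<open>b = 0\<close> division by zero gives
  minus the identity, so every \<open>b\<close> is covered.\<close>

lemma isometric_involution_half_turn:
  fixes b :: R3
  shows "isometric_involution (\<lambda>x. (2 * (x \<bullet> b) / (b \<bullet> b)) *\<^sub>R b - x)"
proof (cases "b = 0")
  case True
  then show ?thesis
    by unfold_locales (auto simp: orthogonal_transformation_def intro!: linearI)
next
  case False
  let ?c = "\<lambda>x. 2 * (x \<bullet> b) / (b \<bullet> b)"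
  have c: "?c x * (b \<bullet> b) = 2 * (x \<bullet> b)" for x
    using False by simp
  show ?thesis
  proof
    show "orthogonal_transformation (\<lambda>x. ?c x *\<^sub>R b - x)"
      unfolding orthogonal_transformation_def
    proof (intro conjI allI)
      show "linear (\<lambda>x. ?c x *\<^sub>R b - x)"
        by (rule linearI) (simp_all add: inner_add_left add_divide_distrib algebra_simps)
      fix x y
      have "(?c x *\<^sub>R b - x) \<bullet> (?c y *\<^sub>R b - y) =
          ?c x * (?c y * (b \<bullet> b)) - ?c x * (y \<bullet> b) - ?c y * (x \<bullet> b) + x \<bullet> y"
        by (simp only: inner_diff_left inner_diff_right inner_scaleR_left inner_scaleR_right
            inner_commute[of b y]) (simp only: algebra_simps)
      \<comment> \<open>The remaining terms cancel because \<open>?c x * (y \<bullet> b)\<close> is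
        symmetric in \<open>x\<close> and \<open>y\<close>.\<close>
      also have "\<dots> = x \<bullet> y"
        unfolding c by simp
      finally show "(?c x *\<^sub>R b - x) \<bullet> (?c y *\<^sub>R b - y) = x \<bullet> y" .
    qed
    fix x
    have "(?c x *\<^sub>R b - x) \<bullet> b = x \<bullet> b"
      using c[of x] by (simp only: inner_diff_left inner_scaleR_left)
    then show "?c (?c x *\<^sub>R b - x) *\<^sub>R b - (?c x *\<^sub>R b - x) = x"
      by simp
  qed
qed

section \<open>Measurability of the potential\<close>

text \<open>The quotient rule applied to the first derivatives of the root. Continuity is assumed
  for the derivatives of the conductivity, so those of its root are eliminated.\<close>

lemma laplacian_sqrt:
  assumes "open D" "x \<in> D" "f differentiable_on D" "\<And>i. partial i f differentiable_on D"
    and pos: "\<And>y. y \<in> D \<Longrightarrow> f y > 0"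
  shows "laplacian (\<lambda>y. sqrt (f y)) x =
    (\<Sum>i\<in>UNIV. partial i (partial i f) x / (2 * sqrt (f x)) - (partial i f x)\<^sup>2 / (4 * sqrt (f x) ^ 3))"
proof -
  let ?s = "\<lambda>y. sqrt (f y)"
  have works: "(g has_derivative (\<lambda>v. dir_deriv v g y)) (at y)"
    if "g differentiable_on D" "y \<in> D" for g :: "R3 \<Rightarrow> real" and y
  proof -
    have "g differentiable (at y)"
      using that \<open>open D\<close> by (simp add: differentiable_on_eq_differentiable_at)
    then show ?thesis by (simp add: frechet_derivative_works dir_deriv_def)
  qed
  have ds: "(?s has_derivative (\<lambda>v. dir_deriv v f y / (2 * ?s y))) (at y)" if "y \<in> D" for y
    using works[OF assms(3) that] pos[OF that]
    by (auto intro!: derivative_eq_intros simp: field_simps)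
  have partial_s: "dir_deriv v ?s y = dir_deriv v f y / (2 * ?s y)" if "y \<in> D" for v y
    using frechet_derivative_at[OF ds[OF that]] by (simp add: dir_deriv_def fun_eq_iff)
  have "partial i (partial i ?s) x =
      partial i (partial i f) x / (2 * ?s x) - (partial i f x)\<^sup>2 / (4 * ?s x ^ 3)" for i
  proof -
    have "((\<lambda>y. partial i f y / (2 * ?s y)) has_derivative
        (\<lambda>v. dir_deriv v (partial i f) x / (2 * ?s x)
           - partial i f x * dir_deriv v f x / (4 * ?s x ^ 3))) (at x)"
    proof (rule has_derivative_eq_rhs)
      show "((\<lambda>y. partial i f y / (2 * ?s y)) has_derivative
        (\<lambda>v. (dir_deriv v (partial i f) x * (2 * ?s x)
           - partial i f x * (2 * (dir_deriv v f x / (2 * ?s x)))) / (2 * ?s x * (2 * ?s x)))) (at x)"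
        using pos[OF \<open>x \<in> D\<close>]
        by (intro has_derivative_divide' has_derivative_mult_right works ds assms) simp
    qed (use pos[OF \<open>x \<in> D\<close>] in \<open>simp add: fun_eq_iff divide_simps power3_eq_cube\<close>)
    \<comment> \<open>The formula for \<open>partial i ?s\<close> is known only on \<open>D\<close>;
      openness allows it to be differentiated at \<open>x\<close>.\<close>
    then have "(partial i ?s has_derivative
        (\<lambda>v. dir_deriv v (partial i f) x / (2 * ?s x)
           - partial i f x * dir_deriv v f x / (4 * ?s x ^ 3))) (at x)"
      using \<open>open D\<close> \<open>x \<in> D\<close>
      by (rule has_derivative_transform_within_open) (simp add: partial_s)
    from frechet_derivative_at[OF this] show ?thesis
      by (simp add: dir_deriv_def[of _ "partial i ?s"] fun_eq_iff power2_eq_square)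
  qed
  then show ?thesis by (simp add: laplacian_def)
qed

lemma extends_continuously_imp_continuous_on:
  assumes "extends_continuously D f"
  shows "continuous_on D f"
proof -
  obtain g where "continuous_on (closure D) g" "\<And>x. x \<in> D \<Longrightarrow> g x = f x"
    using assms unfolding extends_continuously_def by blast
  then show ?thesis
    using closure_subset continuous_on_subset continuous_on_cong by metis
qed

text \<open>The potential is continuous on the ball and 0 elsewhere. Its measurability is what
  allows almost everywhere equal solutions to be exchanged under the scattering integral.\<close>

lemma potential_measurable:
  assumes C2: "C2_closure \<Omega> \<gamma>" and pos: "\<forall>x\<in>closure \<Omega>. \<gamma> x > 0"
  shows "potential \<gamma> \<in> borel_measurable borel"
proof -
  have pos': "\<gamma> x > 0" if "x \<in> \<Omega>" for x
    using pos that closure_subset by blast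
  let ?Q = "\<lambda>x. (\<Sum>i\<in>UNIV. partial i (partial i \<gamma>) x / (2 * sqrt (\<gamma> x))
      - (partial i \<gamma> x)\<^sup>2 / (4 * sqrt (\<gamma> x) ^ 3)) / sqrt (\<gamma> x)"
  have cont: "continuous_on \<Omega> \<gamma>" "\<And>i. continuous_on \<Omega> (partial i \<gamma>)"
    "\<And>i. continuous_on \<Omega> (partial i (partial i \<gamma>))"
    using C2 by (auto simp: C2_closure_def intro: extends_continuously_imp_continuous_on
        differentiable_imp_continuous_on)
  have "continuous_on \<Omega> ?Q"
    using pos' by (intro continuous_intros cont) (auto simp: less_imp_neq[symmetric])
  then have "(\<lambda>x. indicator \<Omega> x *\<^sub>R ?Q x) \<in> borel_measurable borel"
    by (intro borel_measurable_continuous_on_indicator) auto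
  moreover have "potential \<gamma> x = indicator \<Omega> x *\<^sub>R ?Q x" for x
  proof (cases "x \<in> \<Omega>")
    case True
    have "laplacian (\<lambda>y. sqrt (\<gamma> y)) x / sqrt (\<gamma> x) = ?Q x"
      using C2 pos' True by (subst laplacian_sqrt[of \<Omega>]) (auto simp: C2_closure_def)
    with True show ?thesis by (simp add: potential_def)
  qed (simp add: potential_def)
  ultimately show ?thesis by (simp add: fun_eq_iff[symmetric] cong: measurable_cong)
qed

section \<open>The scattering transform\<close>

lemma cdot_add_right: "a \<odot> (b + c) = a \<odot> b + a \<odot> c"
  by (simp add: cdot_def algebra_simps sum.distrib)

lemma cdot_cvec: "cvec x \<odot> cvec y = complex_of_real (x \<bullet> y)"
  by (simp add: cdot_def cvec_def inner_vec_def)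

text \<open>The two exponentials in \<zeta> cancel, leaving a phase that is real in the exponent and
  a dependence on \<zeta> through \<mu> alone.\<close>

lemma scattering_eq:
  "scattering \<delta> q \<xi> \<zeta> =
    (LINT x|lborel. indicator \<Omega> x *\<^sub>R
      (exp (- \<i> * complex_of_real (x \<bullet> \<xi>)) * cgo_mu \<delta> q \<zeta> x * complex_of_real (q x)))"
proof -
  have "exp (- \<i> * (cvec x \<odot> (cvec \<xi> + \<zeta>))) * exp (\<i> * (cvec x \<odot> \<zeta>)) =
      exp (- \<i> * complex_of_real (x \<bullet> \<xi>))" for x
    unfolding exp_add[symmetric] by (simp add: cdot_add_right cdot_cvec algebra_simps)
  then show ?thesis
    by (simp add: scattering_def cgo_psi_def set_lebesgue_integral_def mult.assoc[symmetric])
qed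

lemma (in isometric_involution) scattering_real:
  assumes \<zeta>: "\<And>\<eta>. cvec (S \<eta>) \<odot> \<zeta> = - cnj (cvec \<eta> \<odot> \<zeta>)"
    and \<xi>: "S \<xi> = - \<xi>"
    and q: "\<And>x. q (S x) = q x"
    and q_meas: "q \<in> borel_measurable borel"
    and adm: "admissible \<delta> q \<zeta>"
  shows "cnj (scattering \<delta> q \<xi> \<zeta>) = scattering \<delta> q \<xi> \<zeta>"
proof -
  define \<mu> where "\<mu> = cgo_mu \<delta> q \<zeta>"
  obtain \<mu>0 where \<mu>0: "cgo_solution \<delta> q \<zeta> \<mu>0"
    and unique: "\<And>\<nu>. cgo_solution \<delta> q \<zeta> \<nu> \<Longrightarrow> AE x in lborel. \<nu> x = \<mu>0 x"
    using adm unfolding admissible_def by blast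
  \<comment> \<open>\<open>cgo_mu\<close> is an arbitrary choice among the solutions and may differ
    from \<open>\<mu>0\<close> on a null set.\<close>
  have \<mu>: "cgo_solution \<delta> q \<zeta> \<mu>"
    unfolding \<mu>_def cgo_mu_def using someI[of "cgo_solution \<delta> q \<zeta>", OF \<mu>0] .
  have tw: "cgo_solution \<delta> q \<zeta> (twist \<mu>)"
    using \<zeta> q \<mu> by (rule cgo_solution_twist)
  from unique[OF \<mu>] unique[OF tw] have AE: "AE x in lborel. twist \<mu> x = \<mu> x"
    by eventually_elim simp
  have meas: "\<nu> \<in> borel_measurable borel" if "cgo_solution \<delta> q \<zeta> \<nu>" for \<nu>
  proof -
    have "(\<lambda>x. \<nu> x - 1) \<in> borel_measurable borel"
      using that by (simp add: cgo_solution_def weighted_L2_def)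
    then have "(\<lambda>x. (\<nu> x - 1) + 1) \<in> borel_measurable borel"
      by (rule borel_measurable_add) simp
    then show ?thesis by simp
  qed
  let ?F = "\<lambda>\<nu> x. indicator \<Omega> x *\<^sub>R
      (exp (- \<i> * complex_of_real (x \<bullet> \<xi>)) * \<nu> x * complex_of_real (q x)) :: complex"
  have F_meas: "?F \<nu> \<in> borel_measurable lborel" if "\<nu> \<in> borel_measurable borel" for \<nu>
  proof -
    have "(\<lambda>x. exp (- \<i> * complex_of_real (x \<bullet> \<xi>))) \<in> borel_measurable borel"
      by (intro borel_measurable_continuous_onI continuous_intros)
    moreover have "(\<lambda>x. complex_of_real (q x)) \<in> borel_measurable borel"
      using q_meas by measurable
    ultimately show ?thesis
      using that by (intro borel_measurable_scaleR borel_measurable_times borel_measurable_indicator)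
        auto
  qed
  have "cnj (LINT x|lborel. ?F \<mu> x) = (LINT x|lborel. twist (?F \<mu>) x)"
    by (rule integral_twist[symmetric])
  \<comment> \<open>Conjugation reverses the sign of the exponent and
    \<open>S \<xi> = - \<xi>\<close> restores it; the ball and \<open>q\<close> are invariant under
    \<open>S\<close>.\<close>
  also have "twist (?F \<mu>) = ?F (twist \<mu>)"
    by (simp add: twist_def fun_eq_iff indicator_def q exp_cnj adjoint \<xi>)
  also have "(LINT x|lborel. ?F (twist \<mu>) x) = (LINT x|lborel. ?F \<mu> x)"
  proof (rule integral_cong_AE)
    show "AE x in lborel. ?F (twist \<mu>) x = ?F \<mu> x"
      using AE by eventually_elim simp
  qed (simp_all only: F_meas[OF meas] \<mu> tw)
  finally show ?thesis by (simp only: scattering_eq \<mu>_def)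
qed

theorem corollary3p3:
  fixes \<gamma> :: "real ^ 3 \<Rightarrow> real" and \<delta> :: real
  assumes delta: "-1 < \<delta>" "\<delta> < 0"
    and smooth: "C2_closure \<Omega> \<gamma>"
    and pos: "\<forall>x\<in>closure \<Omega>. \<gamma> x > 0"
    and one_near_boundary:
      "\<exists>U. open U \<and> frontier \<Omega> \<subseteq> U \<and> (\<forall>x\<in>U \<inter> closure \<Omega>. \<gamma> x = 1)"
    and symmetric: "spherically_symmetric (potential \<gamma>)"
  shows "\<forall>\<xi> :: real ^ 3. \<forall>\<zeta> \<in> V_at \<xi>. admissible \<delta> (potential \<gamma>) \<zeta> \<longrightarrow>
           cnj (scattering \<delta> (potential \<gamma>) \<xi> \<zeta>) = scattering \<delta> (potential \<gamma>) \<xi> \<zeta>"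
proof (intro allI ballI impI)
  fix \<xi> :: R3 and \<zeta> assume \<zeta>: "\<zeta> \<in> V_at \<xi>" and adm: "admissible \<delta> (potential \<gamma>) \<zeta>"
  define a :: R3 where "a = (\<chi> j. Re (\<zeta> $ j))"
  define b :: R3 where "b = (\<chi> j. Im (\<zeta> $ j))"
  define S where "S = (\<lambda>x. (2 * (x \<bullet> b) / (b \<bullet> b)) *\<^sub>R b - x)"
  interpret isometric_involution S
    unfolding S_def by (rule isometric_involution_half_turn)
  \<comment> \<open>The imaginary parts of the two quadratic conditions make \<open>a\<close> and
    then \<xi> orthogonal to \<open>b\<close>.\<close>
  have "Im (\<zeta> \<odot> \<zeta>) = 2 * (a \<bullet> b)"
    by (simp add: cdot_def a_def b_def inner_vec_def sum_distrib_left mult.commute)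
  then have ab: "a \<bullet> b = 0"
    using \<zeta> by (simp add: V_at_def V_def)
  have "Im ((cvec \<xi> + \<zeta>) \<odot> (cvec \<xi> + \<zeta>)) = 2 * ((\<xi> + a) \<bullet> b)"
    by (simp add: cdot_def cvec_def a_def b_def inner_vec_def sum_distrib_left mult.commute)
  then have \<xi>b: "\<xi> \<bullet> b = 0"
    using \<zeta> ab by (simp add: V_at_def inner_add_left)
  have cdot: "cvec \<eta> \<odot> \<zeta> = Complex (\<eta> \<bullet> a) (\<eta> \<bullet> b)" for \<eta>
    by (simp add: complex_eq_iff cdot_def cvec_def a_def b_def inner_vec_def)
  show "cnj (scattering \<delta> (potential \<gamma>) \<xi> \<zeta>) = scattering \<delta> (potential \<gamma>) \<xi> \<zeta>"
  proof (rule scattering_real)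
    \<comment> \<open>By self-adjointness \<open>S\<close> passes from \<eta> to \<open>a\<close>
      and \<open>b\<close>, so the real part of the pairing with \<zeta> changes sign and the
      imaginary part stays.\<close>
    have "S a = - a" "S b = b"
      using ab by (auto simp: S_def algebra_simps scaleR_2[symmetric])
    then show "cvec (S \<eta>) \<odot> \<zeta> = - cnj (cvec \<eta> \<odot> \<zeta>)" for \<eta>
      by (simp add: cdot adjoint complex_eq_iff)
    show "S \<xi> = - \<xi>"
      using \<xi>b by (simp add: S_def)
    show "potential \<gamma> (S x) = potential \<gamma> x" for x
      using symmetric norm_S unfolding spherically_symmetric_def by blast
    show "potential \<gamma> \<in> borel_measurable borel"
      using smooth pos by (rule potential_measurable)
  qed (rule adm)
qed

end
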